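(* Let $A$ be an invertible accretive linear operator on a Hilbert space $\mathcal{H}$, and let $L$ be any linear operator such that $V := A - L$ satisfies $\|V\|<1$. Put $\alpha_{\max} := 2\,\mathrm{Re}\left[A^{-1}+(I-V)^{-1}\right]$. Then $\alpha_{\max}>1$, and for every $\alpha$ with $0<\alpha<\alpha_{\max}$ the preconditioner $$\Gamma := (L+I)(I-V)^{-1}\alpha^{-1}$$ is invertible and satisfies $\|I-\Gamma^{-1}A\|<1$.
   Context: $\mathcal{H}$ is a non-empty (complex) Hilbert space with inner product $\langle\cdot,\cdot\rangle$, $I$ is the identity operator, and $\|\cdot\|$ denotes the operator norm. All operators are linear and act on $\mathcal{H}$; they may be unbounded. Bounded operators have all of $\mathcal{H}$ as their domain: a bounded operator given on a smaller domain, such as $I-\Gamma^{-1}A$ on the domain of $A$, is understood to be extended to all of $\mathcal{H}$. In particular $V$ is a bounded operator on $\mathcal{H}$. A (potentially unbounded) operator is called invertible if it has an inverse that is bounded and has domain all of $\mathcal{H}$. For a linear operator $T$ with domain $D(T)\subseteq\mathcal{H}$ define $\mathrm{Re}[T] := \inf_{x\in D(T)\setminus\{0\}} \mathrm{Re}\,\frac{\langle x,Tx\rangle}{\langle x,x\rangle}$. The operator $T$ is accretive if $\mathrm{Re}[T]\ge 0$.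
   Formalization: L is required to have the same domain as A, so that L = A − V; for "any linear operator" the claim fails, e.g. when L is a proper dense restriction of an unbounded A (then V = 0, but L + I is not onto and Γ is not invertible). *)

theory Defs
  imports "HOL-Analysis.Analysis"
begin

section \<open>Complex Hilbert spaces\<close>

text \<open>The inner product is conjugate-linear in its first argument. The real scalar
  multiplication inherited from \<^class>\<open>banach\<close> is the restriction of the complex one.\<close>

class complex_hilbert = banach +
  fixes scaleC :: "complex \<Rightarrow> 'a \<Rightarrow> 'a" (infixr "*\<^sub>C" 75)
    and cinner :: "'a \<Rightarrow> 'a \<Rightarrow> complex"
  assumes scaleR_scaleC: "scaleR r x = complex_of_real r *\<^sub>C x"
    and scaleC_add_right: "c *\<^sub>C (x + y) = c *\<^sub>C x + c *\<^sub>C y"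
    and scaleC_add_left: "(c + d) *\<^sub>C x = c *\<^sub>C x + d *\<^sub>C x"
    and scaleC_scaleC: "c *\<^sub>C d *\<^sub>C x = (c * d) *\<^sub>C x"
    and scaleC_one: "1 *\<^sub>C x = x"
    and cinner_commute: "cinner x y = cnj (cinner y x)"
    and cinner_add_left: "cinner (x + y) z = cinner x z + cinner y z"
    and cinner_scaleC_left: "cinner (c *\<^sub>C x) y = cnj c * cinner x y"
    and cinner_self_ge_zero: "0 \<le> Re (cinner x x)"
    and cinner_self_eq_zero_iff: "cinner x x = 0 \<longleftrightarrow> x = 0"
    and norm_eq_sqrt_cinner: "norm x = sqrt (Re (cinner x x))"

global_interpretation complex_vector: vector_space "scaleC :: complex \<Rightarrow> 'a::complex_hilbert \<Rightarrow> 'a"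
  by unfold_locales
    (simp_all add: scaleC_add_right scaleC_add_left scaleC_scaleC scaleC_one)

instantiation complex :: complex_hilbert
begin
definition scaleC_complex :: "complex \<Rightarrow> complex \<Rightarrow> complex" where "scaleC_complex c x = c * x"
definition cinner_complex :: "complex \<Rightarrow> complex \<Rightarrow> complex" where "cinner_complex x y = cnj x * y"
instance
  by standard
    (auto simp: scaleC_complex_def cinner_complex_def scaleR_conv_of_real algebra_simps
      cmod_def power2_eq_square)
end


section \<open>Possibly unbounded operators\<close>

text \<open>An operator is a partial function; its domain is \<^const>\<open>dom\<close>. Composition with its
  natural domain is \<^const>\<open>map_comp\<close>, the identity is \<^const>\<open>Some\<close>, and ``\<open>S\<close> extends \<open>T\<close>'' is
  \<^const>\<open>map_le\<close>.\<close>

type_synonym 'a operator = "'a \<rightharpoonup> 'a"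

definition linear_operator :: "'a::complex_hilbert operator \<Rightarrow> bool" where
  "linear_operator T \<longleftrightarrow>
     complex_vector.subspace (dom T) \<and>
     (\<forall>x\<in>dom T. \<forall>y\<in>dom T. the (T (x + y)) = the (T x) + the (T y)) \<and>
     (\<forall>c. \<forall>x\<in>dom T. the (T (c *\<^sub>C x)) = c *\<^sub>C the (T x))"

abbreviation (input) op_id :: "'a operator" where
  "op_id \<equiv> Some"

definition op_add :: "'a::complex_hilbert operator \<Rightarrow> 'a operator \<Rightarrow> 'a operator"
    (infixl "+\<^sub>o" 65) where
  "S +\<^sub>o T = (\<lambda>x. if x \<in> dom S \<inter> dom T then Some (the (S x) + the (T x)) else None)"

definition op_diff :: "'a::complex_hilbert operator \<Rightarrow> 'a operator \<Rightarrow> 'a operator"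
    (infixl "-\<^sub>o" 65) where
  "S -\<^sub>o T = (\<lambda>x. if x \<in> dom S \<inter> dom T then Some (the (S x) - the (T x)) else None)"

definition op_scale :: "complex \<Rightarrow> 'a::complex_hilbert operator \<Rightarrow> 'a operator"
    (infixr "*\<^sub>o" 75) where
  "c *\<^sub>o T = map_option (scaleC c) \<circ> T"

text \<open>The domain of the inverse consists of the points with exactly one preimage: for a linear
  operator this is the range if the operator is injective, and empty otherwise.\<close>

definition op_inv :: "'a operator \<Rightarrow> 'a operator" where
  "op_inv T = (\<lambda>y. if \<exists>!x. T x = Some y then Some (THE x. T x = Some y) else None)"

definition bounded_operator :: "'a::complex_hilbert operator \<Rightarrow> bool" where
  "bounded_operator T \<longleftrightarrow>
     linear_operator T \<and> dom T = UNIV \<and> (\<exists>K. \<forall>x. norm (the (T x)) \<le> K * norm x)"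

text \<open>Only meaningful for operators satisfying \<^const>\<open>bounded_operator\<close>.\<close>

definition op_norm :: "'a::complex_hilbert operator \<Rightarrow> real" where
  "op_norm T = onorm (\<lambda>x. the (T x))"

definition bounded_extension :: "'a::complex_hilbert operator \<Rightarrow> 'a operator \<Rightarrow> bool" where
  "bounded_extension T W \<longleftrightarrow> bounded_operator W \<and> T \<subseteq>\<^sub>m W"

definition invertible_op :: "'a::complex_hilbert operator \<Rightarrow> bool" where
  "invertible_op T \<longleftrightarrow> bounded_operator (op_inv T)"

text \<open>Extended-real valued: the infimum is \<open>-\<infinity>\<close> if it is unbounded below, and \<open>\<infinity>\<close> if
  the domain is the zero space.\<close>

definition Re_op :: "'a::complex_hilbert operator \<Rightarrow> ereal" where
  "Re_op T = (INF x\<in>dom T - {0}. ereal (Re (cinner x (the (T x)) / cinner x x)))"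

definition accretive :: "'a::complex_hilbert operator \<Rightarrow> bool" where
  "accretive T \<longleftrightarrow> Re_op T \<ge> 0"


section \<open>The preconditioner\<close>

definition alpha_max :: "'a::complex_hilbert operator \<Rightarrow> 'a operator \<Rightarrow> ereal" where
  "alpha_max A V = 2 * Re_op (op_inv A +\<^sub>o op_inv (op_id -\<^sub>o V))"

definition preconditioner ::
    "'a::complex_hilbert operator \<Rightarrow> 'a operator \<Rightarrow> real \<Rightarrow> 'a operator" where
  "preconditioner L V \<alpha> =
     (L +\<^sub>o op_id) \<circ>\<^sub>m op_inv (op_id -\<^sub>o V) \<circ>\<^sub>m (complex_of_real (inverse \<alpha>) *\<^sub>o op_id)"

end

theory Submission
  imports Defs
begin

text \<open>Everything is expressed through the bounded operators \<open>B = A\<^sup>-\<^sup>1\<close>, \<open>R = (I - V)\<^sup>-\<^sup>1\<close> (a Neumann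
  series, \<open>bounded_clinear_neumann\<close>) and their sum \<open>C = B + R\<close>, for which \<open>\<alpha>\<^sub>m\<^sub>a\<^sub>x = 2 Re[C]\<close>. On the
  domain of \<open>A\<close> one has \<open>L + I = A + (I - V) = (I - V) C A\<close>, and therefore
  \<open>\<Gamma>\<^sup>-\<^sup>1 = \<alpha> (I - V) B C\<^sup>-\<^sup>1 R\<close> as soon as \<open>C\<close> is invertible. From \<open>B = C - R\<close> it follows that
  \<open>B C\<^sup>-\<^sup>1 R = R - R C\<^sup>-\<^sup>1 R = R C\<^sup>-\<^sup>1 B\<close>, so that \<open>\<Gamma>\<^sup>-\<^sup>1 A\<close> is just the restriction of \<open>\<alpha> C\<^sup>-\<^sup>1\<close> to the
  domain of \<open>A\<close>.

  Since \<open>A\<close> is accretive, so is \<open>B\<close>, and \<open>\<parallel>V\<parallel> < 1\<close> makes \<open>2 Re[R]\<close> strictly larger than \<open>1\<close>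
  (\<open>resolvent_coercive\<close>). This gives \<open>\<alpha>\<^sub>m\<^sub>a\<^sub>x > 1\<close>, and it also makes \<open>C\<close> coercive, hence
  invertible (\<open>bounded_clinear_lax_milgram\<close>). The norm estimate for \<open>I - \<alpha> C\<^sup>-\<^sup>1\<close> is a completion of
  the square that works exactly because \<open>\<alpha> < 2 Re[C]\<close>
  (\<open>onorm_ident_minus_inverse_less_1\<close>).

  The bounded extension of \<open>I - \<Gamma>\<^sup>-\<^sup>1 A\<close> is unique because the domain of \<open>A\<close>, which is the range of
  \<open>B\<close>, is dense: accretivity forces a vector orthogonal to the range of \<open>B\<close> into the kernel of
  \<open>B\<close> (\<open>accretive_injective_dense_range\<close>).\<close>

section \<open>The real inner product\<close>

definition rinner :: "'a::complex_hilbert \<Rightarrow> 'a \<Rightarrow> real" where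
  "rinner x y = Re (cinner x y)"

lemma rinner_commute: "rinner x y = rinner y x"
  unfolding rinner_def by (subst cinner_commute) simp

lemma rinner_add_left: "rinner (x + y) z = rinner x z + rinner y z"
  by (simp add: rinner_def cinner_add_left)

lemma rinner_scaleR_left: "rinner (r *\<^sub>R x) y = r * rinner x y"
  by (simp add: rinner_def scaleR_scaleC cinner_scaleC_left)

lemma rinner_add_right: "rinner x (y + z) = rinner x y + rinner x z"
  by (metis rinner_commute rinner_add_left)

lemma rinner_scaleR_right: "rinner x (r *\<^sub>R y) = r * rinner x y"
  by (metis rinner_commute rinner_scaleR_left)

lemma rinner_minus_left: "rinner (- x) y = - rinner x y"
  using rinner_scaleR_left[of "-1" x y] by simp

lemma rinner_minus_right: "rinner x (- y) = - rinner x y"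
  by (metis rinner_commute rinner_minus_left)

lemma rinner_diff_left: "rinner (x - y) z = rinner x z - rinner y z"
  using rinner_add_left[of x "- y" z] by (simp add: rinner_minus_left)

lemma rinner_diff_right: "rinner x (y - z) = rinner x y - rinner x z"
  by (metis rinner_commute rinner_diff_left)

lemmas rinner_simps = rinner_add_left rinner_add_right rinner_diff_left rinner_diff_right
  rinner_minus_left rinner_minus_right rinner_scaleR_left rinner_scaleR_right

lemma norm_sq_eq_rinner: "(norm x)\<^sup>2 = rinner x x"
  by (simp add: rinner_def norm_eq_sqrt_cinner cinner_self_ge_zero)

lemma rinner_eq_zero_iff: "rinner x x = 0 \<longleftrightarrow> x = 0"
  by (metis norm_sq_eq_rinner power_eq_0_iff norm_eq_zero zero_neq_numeral zero_power2)

lemma norm_diff_sq: "(norm (x - y))\<^sup>2 = (norm x)\<^sup>2 - 2 * rinner x y + (norm y)\<^sup>2"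
  by (simp add: norm_sq_eq_rinner rinner_simps rinner_commute[of y x])

lemma parallelogram: "(norm (x + y))\<^sup>2 + (norm (x - y))\<^sup>2 = 2 * (norm x)\<^sup>2 + 2 * (norm y)\<^sup>2"
  for x :: "'a::complex_hilbert"
  by (simp add: norm_sq_eq_rinner rinner_simps)

text \<open>This carries the two variational arguments of the next part. The quadratic in
  \<open>t\<close> touches its minimum at \<open>0\<close>, so its linear coefficient vanishes.\<close>

lemma linear_coeff_zero_of_quadratic_ge:
  fixes a b :: real
  assumes "\<And>t. 0 \<le> t * a + t\<^sup>2 * b"
  shows "a = 0"
proof (rule ccontr)
  assume "a \<noteq> 0"
  define s where "s = \<bar>b\<bar> + 1"
  have s: "s > 0" "b < s" by (auto simp: s_def)
  \<comment> \<open>At \<open>t = - a / s\<close> the quadratic has the sign of \<open>b - s < 0\<close>.\<close>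
  have "(- a / s) * a + (- a / s)\<^sup>2 * b = (a / s)\<^sup>2 * (b - s)"
    using s(1) by (simp add: field_simps power2_eq_square)
  also have "\<dots> < 0"
    using \<open>a \<noteq> 0\<close> s by (intro mult_pos_neg) auto
  finally show False using assms[of "- a / s"] by simp
qed

section \<open>Dense subspaces\<close>

text \<open>A point of the closure of \<open>S\<close> nearest to \<open>y\<close> exists by completeness, and the error
  vector is orthogonal to \<open>S\<close>. If only \<open>0\<close> is orthogonal to \<open>S\<close>, then \<open>y\<close> is that point.\<close>

lemma dense_if_orthogonal_trivial:
  fixes S :: "'a::complex_hilbert set"
  assumes S: "subspace S"
    and orth: "\<And>y. (\<And>s. s \<in> S \<Longrightarrow> rinner y s = 0) \<Longrightarrow> y = 0"
  shows "closure S = UNIV"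
proof -
  have "y \<in> closure S" for y
  proof -
    define d where "d = infdist y S"
    have ne: "S \<noteq> {}" using subspace_0[OF S] by auto
    have d0: "0 \<le> d" unfolding d_def by (rule infdist_nonneg)
    have d_le: "d \<le> norm (y - s)" if "s \<in> S" for s
      using infdist_le[OF that, of y] by (simp add: d_def dist_norm)
    have "\<exists>s\<in>S. norm (y - s) < d + e" if "e > 0" for e
    proof (rule ccontr)
      assume "\<not> ?thesis"
      then have "d + e \<le> infdist y S"
        unfolding infdist_def using ne by (auto simp: dist_norm not_less intro!: cINF_greatest)
      then show False using that by (simp add: d_def)
    qed
    then have "\<forall>n. \<exists>s. s \<in> S \<and> norm (y - s) < d + inverse (real (Suc n))"
      by (metis inverse_positive_iff_positive of_nat_0_less_iff zero_less_Suc)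
    then obtain s where s: "\<And>n. s n \<in> S" "\<And>n. norm (y - s n) < d + inverse (real (Suc n))"
      by metis
    have lim: "(\<lambda>n. norm (y - s n)) \<longlonglongrightarrow> d"
    proof (rule tendsto_sandwich[where f = "\<lambda>_. d" and h = "\<lambda>n. d + inverse (real (Suc n))"])
      show "(\<lambda>n. d + inverse (real (Suc n))) \<longlonglongrightarrow> d"
        using tendsto_add[OF tendsto_const LIMSEQ_inverse_real_of_nat, of d] by simp
    qed (use d_le s in \<open>simp_all add: less_imp_le del: of_nat_Suc\<close>)
    \<comment> \<open>The midpoint of two points of \<open>S\<close> stays at distance at least \<open>d\<close>, so the parallelogram
      law makes any minimising sequence Cauchy.\<close>
    have close: "(norm (s m - s n))\<^sup>2
        \<le> 2 * ((norm (y - s m))\<^sup>2 - d\<^sup>2) + 2 * ((norm (y - s n))\<^sup>2 - d\<^sup>2)" for m n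
    proof -
      have "(1/2) *\<^sub>R (s m + s n) \<in> S"
        using S s by (intro subspace_scale subspace_add)
      then have "2 * d \<le> 2 * norm (y - (1/2) *\<^sub>R (s m + s n))" using d_le by simp
      also have "\<dots> = norm (2 *\<^sub>R (y - (1/2) *\<^sub>R (s m + s n)))" by simp
      also have "2 *\<^sub>R (y - (1/2) *\<^sub>R (s m + s n)) = (y - s m) + (y - s n)"
        by (simp add: algebra_simps scaleR_2)
      finally have "4 * d\<^sup>2 \<le> (norm ((y - s m) + (y - s n)))\<^sup>2"
        using power_mono[of "2 * d" _ 2] d0 by (fastforce simp: power_mult_distrib)
      moreover have "norm ((y - s m) - (y - s n)) = norm (s m - s n)"
        by (simp add: norm_minus_commute)
      ultimately show ?thesis
        using parallelogram[of "y - s m" "y - s n"] by simp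
    qed
    have "Cauchy s"
    proof (rule metric_CauchyI)
      fix e :: real assume e: "0 < e"
      have "(\<lambda>n. (norm (y - s n))\<^sup>2 - d\<^sup>2) \<longlonglongrightarrow> d\<^sup>2 - d\<^sup>2"
        by (intro tendsto_intros lim)
      then have "\<forall>\<^sub>F n in sequentially. (norm (y - s n))\<^sup>2 - d\<^sup>2 < e\<^sup>2 / 4"
        by (rule order_tendstoD) (use e in simp)
      then obtain N where N: "\<And>n. n \<ge> N \<Longrightarrow> (norm (y - s n))\<^sup>2 - d\<^sup>2 < e\<^sup>2 / 4"
        by (auto simp: eventually_sequentially)
      have "dist (s m) (s n) < e" if "m \<ge> N" "n \<ge> N" for m n
      proof -
        have "(norm (s m - s n))\<^sup>2 < e\<^sup>2" using close[of m n] N[OF that(1)] N[OF that(2)] by simp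
        then show ?thesis using e power_less_imp_less_base[of _ 2 e] by (simp add: dist_norm)
      qed
      then show "\<exists>M. \<forall>m\<ge>M. \<forall>n\<ge>M. dist (s m) (s n) < e" by blast
    qed
    then obtain p where p: "s \<longlonglongrightarrow> p"
      using Cauchy_convergent convergent_def by blast
    have norm_p: "norm (y - p) = d"
      by (rule LIMSEQ_unique[OF _ lim]) (intro tendsto_intros p)
    have "rinner (y - p) t = 0" if t: "t \<in> S" for t
    proof -
      have ge: "d \<le> norm (y - p - r *\<^sub>R t)" for r
      proof (rule LIMSEQ_le_const)
        show "(\<lambda>n. norm (y - s n - r *\<^sub>R t)) \<longlonglongrightarrow> norm (y - p - r *\<^sub>R t)"
          by (intro tendsto_intros p)
        have "s n + r *\<^sub>R t \<in> S" for n using S s t by (intro subspace_add subspace_scale)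
        then show "\<exists>N. \<forall>n\<ge>N. d \<le> norm (y - s n - r *\<^sub>R t)"
          using d_le by (metis diff_diff_eq)
      qed
      have "0 \<le> r * (- 2 * rinner (y - p) t) + r\<^sup>2 * (norm t)\<^sup>2" for r
      proof -
        have "(norm (y - p))\<^sup>2 \<le> (norm (y - p - r *\<^sub>R t))\<^sup>2"
          using ge[of r] d0 norm_p by (intro power_mono) auto
        then show ?thesis
          unfolding norm_diff_sq[of "y - p"]
          by (simp add: rinner_simps power_mult_distrib algebra_simps)
      qed
      then have "- 2 * rinner (y - p) t = 0" by (rule linear_coeff_zero_of_quadratic_ge)
      then show ?thesis by simp
    qed
    then have "y = p" using orth[of "y - p"] by simp
    then show ?thesis using s(1) p closure_sequential by blast
  qed
  then show ?thesis by auto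
qed

text \<open>A bounded accretive operator and its adjoint have the same kernel: perturbing \<open>y\<close> in the
  quadratic form of \<open>B\<close> turns \<open>y \<bottom> range B\<close> into \<open>B y = 0\<close>.\<close>

lemma accretive_injective_dense_range:
  fixes B :: "'a::complex_hilbert \<Rightarrow> 'a"
  assumes B: "linear B" and inj: "inj B" and acc: "\<And>x. 0 \<le> rinner x (B x)"
  shows "closure (range B) = UNIV"
proof (rule dense_if_orthogonal_trivial)
  show "subspace (range B)" using B by (simp add: linear_subspace_image)
next
  fix y assume "\<And>s. s \<in> range B \<Longrightarrow> rinner y s = 0"
  then have y: "rinner y (B z) = 0" for z by simp
  have "rinner (B y) z = 0" for z
  proof (rule linear_coeff_zero_of_quadratic_ge)
    fix t :: real
    have "0 \<le> rinner (y + t *\<^sub>R z) (B (y + t *\<^sub>R z))" by (rule acc)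
    also have "\<dots> = t * rinner (B y) z + t\<^sup>2 * rinner z (B z)"
      using y by (simp add: linear_add[OF B] linear_cmul[OF B] rinner_simps
          rinner_commute[of z "B y"] power2_eq_square)
    finally show "0 \<le> t * rinner (B y) z + t\<^sup>2 * rinner z (B z)" .
  qed
  from this[of "B y"] have "B y = B 0" using linear_0[OF B] by (simp add: rinner_eq_zero_iff)
  then show "y = 0" using inj by (simp add: inj_eq)
qed

section \<open>Everywhere defined bounded operators\<close>

definition bounded_clinear :: "('a::complex_hilbert \<Rightarrow> 'a) \<Rightarrow> bool" where
  "bounded_clinear f \<longleftrightarrow> bounded_linear f \<and> (\<forall>c x. f (c *\<^sub>C x) = c *\<^sub>C f x)"

lemma scaleC_scaleR_commute: "c *\<^sub>C (r *\<^sub>R x) = r *\<^sub>R (c *\<^sub>C x)" for x :: "'a::complex_hilbert"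
  by (simp add: scaleR_scaleC scaleC_scaleC mult.commute)

lemma bounded_operator_total_iff: "bounded_operator (\<lambda>x. Some (f x)) \<longleftrightarrow> bounded_clinear f"
proof
  assume f: "bounded_operator (\<lambda>x. Some (f x))"
  then obtain K where K: "\<And>x. norm (f x) \<le> K * norm x"
    and add: "\<And>x y. f (x + y) = f x + f y" and scale: "\<And>c x. f (c *\<^sub>C x) = c *\<^sub>C f x"
    by (auto simp: bounded_operator_def linear_operator_def dom_def)
  have "bounded_linear f"
    using K by (intro bounded_linear_intro[of f K])
      (simp_all add: add scale scaleR_scaleC mult.commute)
  then show "bounded_clinear f" by (simp add: bounded_clinear_def scale)
next
  assume f: "bounded_clinear f"
  then interpret bounded_linear f by (simp add: bounded_clinear_def)
  show "bounded_operator (\<lambda>x. Some (f x))"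
    using f bounded
    by (auto simp: bounded_operator_def linear_operator_def bounded_clinear_def add dom_def
        complex_vector.subspace_UNIV mult.commute)
qed

lemma bounded_operatorE:
  assumes "bounded_operator T"
  obtains f where "T = (\<lambda>x. Some (f x))" "bounded_clinear f"
proof
  show eq: "T = (\<lambda>x. Some (the (T x)))"
  proof
    fix x have "x \<in> dom T" using assms by (simp add: bounded_operator_def)
    then show "T x = Some (the (T x))" by auto
  qed
  show "bounded_clinear (\<lambda>x. the (T x))"
    using assms eq by (metis bounded_operator_total_iff)
qed

lemma bounded_clinear_bounded_linear: "bounded_clinear f \<Longrightarrow> bounded_linear f"
  by (simp add: bounded_clinear_def)

lemma bounded_clinear_ident: "bounded_clinear (\<lambda>x. x)"
  by (simp add: bounded_clinear_def bounded_linear_ident)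

lemma bounded_clinear_add:
  "bounded_clinear f \<Longrightarrow> bounded_clinear g \<Longrightarrow> bounded_clinear (\<lambda>x. f x + g x)"
  by (simp add: bounded_clinear_def bounded_linear_add scaleC_add_right)

lemma bounded_clinear_diff:
  "bounded_clinear f \<Longrightarrow> bounded_clinear g \<Longrightarrow> bounded_clinear (\<lambda>x. f x - g x)"
  by (simp add: bounded_clinear_def bounded_linear_sub complex_vector.scale_right_diff_distrib)

lemma bounded_clinear_scaleR: "bounded_clinear f \<Longrightarrow> bounded_clinear (\<lambda>x. r *\<^sub>R f x)"
  by (simp add: bounded_clinear_def bounded_linear_const_scaleR scaleC_scaleR_commute)

lemma bounded_clinear_compose:
  "bounded_clinear f \<Longrightarrow> bounded_clinear g \<Longrightarrow> bounded_clinear (\<lambda>x. f (g x))"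
  by (simp add: bounded_clinear_def bounded_linear_compose)

lemmas bounded_clinear_intros = bounded_clinear_ident bounded_clinear_add bounded_clinear_diff
  bounded_clinear_scaleR

text \<open>The equation \<open>x - f x = y\<close> is the fixed point equation of the contraction \<open>x \<mapsto> y + f x\<close>.
  Linearity of the solution map follows from uniqueness of the fixed point.\<close>

lemma bounded_clinear_neumann:
  fixes f :: "'a::complex_hilbert \<Rightarrow> 'a"
  assumes f: "bounded_clinear f" and bound: "\<And>x. norm (f x) \<le> q * norm x" and q: "q < 1"
  obtains g where "bounded_clinear g" "\<And>x y. x - f x = y \<longleftrightarrow> x = g y"
proof -
  interpret f: bounded_linear f using f by (rule bounded_clinear_bounded_linear)
  \<comment> \<open>On the zero space \<open>q\<close> may be negative.\<close>
  define r where "r = max q 0"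
  have r: "0 \<le> r" "r < 1" using q by (auto simp: r_def)
  have fr: "norm (f x) \<le> r * norm x" for x
    using bound[of x] mult_right_mono[of q r "norm x"] by (simp add: r_def)
  have "\<exists>!x. x - f x = y" for y
  proof -
    have "\<exists>!x. y + f x = x"
      by (rule banach_fix_type[OF r]) (simp add: dist_norm fr flip: f.diff)
    then show ?thesis by (simp add: algebra_simps eq_commute)
  qed
  then obtain g where g: "\<And>x y. x - f x = y \<longleftrightarrow> x = g y" by metis
  have inv: "g y - f (g y) = y" for y using g by blast
  have g_scaleC: "g (c *\<^sub>C y) = c *\<^sub>C g y" for c y
  proof -
    have "c *\<^sub>C g y - f (c *\<^sub>C g y) = c *\<^sub>C (g y - f (g y))"
      using f by (simp add: bounded_clinear_def complex_vector.scale_right_diff_distrib)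
    then show ?thesis using g inv by metis
  qed
  have "bounded_linear g"
  proof (rule bounded_linear_intro)
    fix x y r
    have "g x + g y - f (g x + g y) = (g x - f (g x)) + (g y - f (g y))"
      by (simp add: f.add)
    then show "g (x + y) = g x + g y" using g inv by metis
    show "g (r *\<^sub>R y) = r *\<^sub>R g y" by (simp add: scaleR_scaleC g_scaleC)
  next
    fix y
    have "norm (g y) \<le> norm (g y - f (g y)) + norm (f (g y))"
      by (metis diff_add_cancel norm_triangle_ineq)
    then have "(1 - r) * norm (g y) \<le> norm y"
      using fr[of "g y"] by (simp add: inv algebra_simps)
    then show "norm (g y) \<le> norm y * inverse (1 - r)" using r by (simp add: field_simps)
  qed
  with g_scaleC g show thesis by (intro that) (auto simp: bounded_clinear_def)
qed

text \<open>For small \<open>t > 0\<close> the operator \<open>I - t C\<close> is a strict contraction, because expanding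
  \<open>\<parallel>x - t C x\<parallel>\<^sup>2\<close> the term of first order in \<open>t\<close> is negative. Hence \<open>t C\<close> is inverted by a
  Neumann series (this is the Lax-Milgram theorem).\<close>

lemma bounded_clinear_lax_milgram:
  fixes C :: "'a::complex_hilbert \<Rightarrow> 'a"
  assumes C: "bounded_clinear C" and m: "m > 0"
    and coercive: "\<And>x. m * (norm x)\<^sup>2 \<le> rinner x (C x)"
  obtains D where "bounded_clinear D" "\<And>x y. C x = y \<longleftrightarrow> x = D y"
proof -
  interpret C: bounded_linear C using C by (rule bounded_clinear_bounded_linear)
  obtain K where K: "K > 0" "\<And>x. norm (C x) \<le> norm x * K" using C.pos_bounded by blast
  \<comment> \<open>The choice \<open>t = m / K\<^sup>2\<close> minimises \<open>1 - 2 t m + t\<^sup>2 K\<^sup>2\<close>; enlarging the denominator ensures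
    \<open>t m \<le> 1\<close> as well, since on the zero space \<open>K\<close> may be smaller than \<open>m\<close>.\<close>
  define t where "t = m / (K\<^sup>2 + m\<^sup>2)"
  have t: "t > 0" using m K by (simp add: t_def add_pos_pos)
  have tK: "t * K\<^sup>2 \<le> m" "t * m \<le> 1"
  proof -
    have "K\<^sup>2 + m\<^sup>2 > 0" using m by (simp add: add_nonneg_pos)
    then show "t * K\<^sup>2 \<le> m" "t * m \<le> 1"
      using m by (simp_all add: t_def pos_divide_le_eq distrib_left power2_eq_square)
  qed
  have sq: "(norm (x - t *\<^sub>R C x))\<^sup>2 \<le> (1 - t * m) * (norm x)\<^sup>2" for x
  proof -
    have "(norm (x - t *\<^sub>R C x))\<^sup>2 = (norm x)\<^sup>2 - 2 * t * rinner x (C x) + t\<^sup>2 * (norm (C x))\<^sup>2"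
      unfolding norm_diff_sq by (simp add: rinner_simps power_mult_distrib)
    also have "\<dots> \<le> (norm x)\<^sup>2 - 2 * t * (m * (norm x)\<^sup>2) + t\<^sup>2 * (norm x * K)\<^sup>2"
      using t K(2)[of x] coercive[of x] by (intro add_mono diff_mono mult_left_mono power_mono) auto
    also have "\<dots> = (norm x)\<^sup>2 - 2 * t * (m * (norm x)\<^sup>2) + (t * K\<^sup>2) * (t * (norm x)\<^sup>2)"
      by (simp add: power2_eq_square algebra_simps)
    also have "\<dots> \<le> (norm x)\<^sup>2 - 2 * t * (m * (norm x)\<^sup>2) + m * (t * (norm x)\<^sup>2)"
      using tK t by (intro add_left_mono mult_right_mono) auto
    finally show ?thesis by (simp add: algebra_simps)
  qed
  have contraction: "norm (x - t *\<^sub>R C x) \<le> sqrt (1 - t * m) * norm x" for x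
    using real_sqrt_le_mono[OF sq[of x]] by (simp add: real_sqrt_mult)
  have factor: "sqrt (1 - t * m) < 1" using t m by simp
  have "bounded_clinear (\<lambda>x. x - t *\<^sub>R C x)" using C by (intro bounded_clinear_intros)
  then obtain g where g: "bounded_clinear g"
    "\<And>x y. x - (x - t *\<^sub>R C x) = y \<longleftrightarrow> x = g y"
    using bounded_clinear_neumann[OF _ contraction factor] by blast
  have "C x = y \<longleftrightarrow> x = g (t *\<^sub>R y)" for x y
    using g(2)[of x "t *\<^sub>R y"] t by simp
  moreover have "bounded_clinear (\<lambda>y. g (t *\<^sub>R y))"
    using g(1) by (rule bounded_clinear_compose) (intro bounded_clinear_intros)
  ultimately show thesis by (rule that[rotated])
qed

section \<open>Partial operators in terms of total maps\<close>

lemma op_inv_eqI: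
  assumes "\<And>x y. T x = Some y \<longleftrightarrow> x = g y"
  shows "op_inv T = (\<lambda>y. Some (g y))"
  by (auto simp: op_inv_def assms)

lemma invertible_opE:
  assumes "invertible_op T"
  obtains g where "bounded_clinear g" "\<And>x y. T x = Some y \<longleftrightarrow> x = g y"
proof -
  obtain g where g: "op_inv T = (\<lambda>y. Some (g y))" "bounded_clinear g"
    using assms unfolding invertible_op_def by (rule bounded_operatorE)
  have "T x = Some y \<longleftrightarrow> x = g y" for x y
  proof -
    have inv: "op_inv T y = Some (g y)" using g by simp
    then have ex1: "\<exists>!x. T x = Some y" by (auto simp: op_inv_def split: if_splits)
    then have "g y = (THE x. T x = Some y)" using inv by (simp add: op_inv_def)
    then have "T (g y) = Some y" using theI'[OF ex1] by simp
    then show ?thesis using ex1 by blast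
  qed
  with g show thesis using that by blast
qed

text \<open>Clearing the denominator turns a bound on the numerical range into a quadratic form
  inequality, which holds trivially at the vector \<open>0\<close> that the infimum leaves out.\<close>

lemma Re_op_ge_iff:
  "ereal m \<le> Re_op T \<longleftrightarrow> (\<forall>x\<in>dom T. m * (norm x)\<^sup>2 \<le> rinner x (the (T x)))"
proof -
  have "m \<le> Re (cinner x (the (T x)) / cinner x x) \<longleftrightarrow> m * (norm x)\<^sup>2 \<le> rinner x (the (T x))"
    if "x \<noteq> 0" for x
  proof -
    have "Im (cinner x x) = 0" using cinner_commute[of x x] by (metis cnj.simps(2) equal_neg_zero)
    then have "cinner x x = complex_of_real ((norm x)\<^sup>2)"
      by (simp add: complex_eq_iff norm_sq_eq_rinner rinner_def)
    then show ?thesis using that by (simp add: rinner_def pos_le_divide_eq)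
  qed
  moreover have "m * (norm x)\<^sup>2 \<le> rinner x (the (T x))" if "x = 0" for x
    using that rinner_scaleR_left[of 0 0 "the (T x)"] by simp
  ultimately show ?thesis
    unfolding Re_op_def le_INF_iff ereal_less_eq by (metis Diff_iff singletonD singletonI)
qed

text \<open>With \<open>x = (I - V) u\<close> one has \<open>2 Re \<langle>x, u\<rangle> - \<parallel>x\<parallel>\<^sup>2 = \<parallel>u\<parallel>\<^sup>2 - \<parallel>V u\<parallel>\<^sup>2\<close>, and the right-hand side
  is a positive multiple of \<open>\<parallel>u\<parallel>\<^sup>2\<close>.\<close>

lemma resolvent_coercive:
  fixes V R :: "'a::complex_hilbert \<Rightarrow> 'a"
  assumes V: "\<And>x. norm (V x) \<le> v * norm x" and v: "0 \<le> v" "v < 1"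
    and R: "\<And>x. R x - V (R x) = x"
  shows "(1 + (1 - v) / (1 + v)) * (norm x)\<^sup>2 \<le> 2 * rinner x (R x)"
proof -
  define u where "u = R x"
  have "V u = u - x" using R[of x] by (simp add: u_def algebra_simps)
  then have id: "2 * rinner x u - (norm x)\<^sup>2 = (norm u)\<^sup>2 - (norm (V u))\<^sup>2"
    by (simp add: norm_diff_sq rinner_commute)
  have "(norm (V u))\<^sup>2 \<le> (v * norm u)\<^sup>2" using V[of u] by (intro power_mono) auto
  then have 1: "(1 - v\<^sup>2) * (norm u)\<^sup>2 \<le> 2 * rinner x u - (norm x)\<^sup>2"
    unfolding id by (simp add: power_mult_distrib algebra_simps)
  have "norm x \<le> norm u + norm (V u)" using R[of x] norm_triangle_ineq4 by (metis u_def)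
  then have "norm x \<le> (1 + v) * norm u" using V[of u] by (simp add: algebra_simps)
  then have "(norm x)\<^sup>2 \<le> ((1 + v) * norm u)\<^sup>2" by (intro power_mono) auto
  then have "(1 - v) / (1 + v) * (norm x)\<^sup>2 \<le> (1 - v) / (1 + v) * ((1 + v) * norm u)\<^sup>2"
    using v by (intro mult_left_mono) auto
  also have "\<dots> = (1 - v\<^sup>2) * (norm u)\<^sup>2"
    using v by (simp add: power2_eq_square field_simps)
  finally show ?thesis using 1 by (simp add: u_def algebra_simps)
qed

text \<open>With \<open>x = C u\<close> one has \<open>\<parallel>C u - \<alpha> u\<parallel>\<^sup>2 = \<parallel>C u\<parallel>\<^sup>2 - \<alpha> (2 Re \<langle>u, C u\<rangle> - \<alpha> \<parallel>u\<parallel>\<^sup>2)\<close>; boundedness of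
  \<open>C\<close> turns the gain, a multiple of \<open>\<parallel>u\<parallel>\<^sup>2\<close>, into a fixed fraction of \<open>\<parallel>x\<parallel>\<^sup>2\<close>.\<close>

lemma onorm_ident_minus_inverse_less_1:
  fixes C D :: "'a::complex_hilbert \<Rightarrow> 'a"
  assumes C: "bounded_clinear C" and D: "\<And>x. C (D x) = x"
    and coercive: "\<And>x. \<beta> * (norm x)\<^sup>2 \<le> 2 * rinner x (C x)" and \<alpha>: "0 < \<alpha>" "\<alpha> < \<beta>"
  shows "onorm (\<lambda>x. x - \<alpha> *\<^sub>R D x) < 1"
proof -
  interpret C: bounded_linear C using C by (rule bounded_clinear_bounded_linear)
  obtain K where K: "K > 0" "\<And>x. norm (C x) \<le> norm x * K" using C.pos_bounded by blast
  define \<delta> where "\<delta> = \<alpha> * (\<beta> - \<alpha>) / K\<^sup>2"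
  have \<delta>: "\<delta> > 0" using \<alpha> K by (simp add: \<delta>_def)
  have sq: "(norm (x - \<alpha> *\<^sub>R D x))\<^sup>2 \<le> (1 - \<delta>) * (norm x)\<^sup>2" for x
  proof -
    define u where "u = D x"
    have x: "x = C u" by (simp add: u_def D)
    have "(norm x)\<^sup>2 \<le> (norm u * K)\<^sup>2" unfolding x using K(2) by (intro power_mono) auto
    then have "\<delta> * (norm x)\<^sup>2 \<le> \<delta> * (norm u * K)\<^sup>2" using \<delta> by (intro mult_left_mono) auto
    also have "\<dots> = \<alpha> * (\<beta> * (norm u)\<^sup>2 - \<alpha> * (norm u)\<^sup>2)"
      using K(1) by (simp add: \<delta>_def power_mult_distrib) (simp add: algebra_simps)
    also have "\<dots> \<le> \<alpha> * (2 * rinner u x - \<alpha> * (norm u)\<^sup>2)"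
      using coercive[of u] \<alpha> by (intro mult_left_mono diff_right_mono) (auto simp: x)
    also have "\<dots> = (norm x)\<^sup>2 - (norm (x - \<alpha> *\<^sub>R u))\<^sup>2"
      unfolding norm_diff_sq
      by (simp add: rinner_simps rinner_commute[of u x] power_mult_distrib power2_eq_square algebra_simps)
    finally show ?thesis by (simp add: u_def algebra_simps)
  qed
  \<comment> \<open>On the zero space \<open>K\<close> may be so small that \<open>1 - \<delta>\<close> is negative.\<close>
  have "norm (x - \<alpha> *\<^sub>R D x) \<le> sqrt (max 0 (1 - \<delta>)) * norm x" for x
  proof -
    have "(norm (x - \<alpha> *\<^sub>R D x))\<^sup>2 \<le> max 0 (1 - \<delta>) * (norm x)\<^sup>2"
      by (rule order_trans[OF sq]) (intro mult_right_mono, auto)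
    from real_sqrt_le_mono[OF this] show ?thesis by (simp add: real_sqrt_mult)
  qed
  then have "onorm (\<lambda>x. x - \<alpha> *\<^sub>R D x) \<le> sqrt (max 0 (1 - \<delta>))"
    by (intro onorm_bound) auto
  also have "\<dots> < 1" using \<delta> by simp
  finally show ?thesis .
qed

section \<open>The preconditioner\<close>

theorem theorem1:
  fixes A L V :: "'a::complex_hilbert operator"
  assumes "linear_operator A" and "invertible_op A" and "accretive A"
    and "linear_operator L" and "dom L = dom A"
    and "bounded_extension (A -\<^sub>o L) V" and "op_norm V < 1"
  shows "alpha_max A V > 1 \<and>
    (\<forall>\<alpha>::real. 0 < \<alpha> \<and> ereal \<alpha> < alpha_max A V \<longrightarrow>
       invertible_op (preconditioner L V \<alpha>) \<and>
       (\<exists>!W. bounded_extension (op_id -\<^sub>o (op_inv (preconditioner L V \<alpha>) \<circ>\<^sub>m A)) W) \<and>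
       (\<forall>W. bounded_extension (op_id -\<^sub>o (op_inv (preconditioner L V \<alpha>) \<circ>\<^sub>m A)) W
              \<longrightarrow> op_norm W < 1))"
proof -
  obtain B where B: "bounded_clinear B" and A_iff: "\<And>x y. A x = Some y \<longleftrightarrow> x = B y"
    using invertible_opE[OF assms(2)] by blast
  have A_B: "A (B y) = Some y" for y by (simp add: A_iff)
  have dom_A: "dom A = range B" by (auto simp: A_iff)
  have inj_B: "inj B" by (rule injI) (metis A_B option.inject)
  obtain V' where V_eq: "V = (\<lambda>x. Some (V' x))" and V': "bounded_clinear V'"
    using assms(6) unfolding bounded_extension_def by (auto elim: bounded_operatorE)
  interpret V': bounded_linear V' using V' by (rule bounded_clinear_bounded_linear)
  define v where "v = onorm V'"
  have v: "0 \<le> v" "v < 1"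
    using assms(7) onorm_pos_le[OF V'.bounded_linear_axioms] by (simp_all add: v_def op_norm_def V_eq)
  have V'_le: "norm (V' x) \<le> v * norm x" for x
    unfolding v_def by (rule onorm[OF V'.bounded_linear_axioms])
  obtain R where R: "bounded_clinear R" and R_iff: "\<And>x y. x - V' x = y \<longleftrightarrow> x = R y"
    using bounded_clinear_neumann[OF V' V'_le v(2)] by blast
  have inv_R: "R x - V' (R x) = x" for x using R_iff by blast
  have R_inv: "R (x - V' x) = x" for x using R_iff by metis
  interpret R: bounded_linear R using R by (rule bounded_clinear_bounded_linear)
  interpret B: bounded_linear B using B by (rule bounded_clinear_bounded_linear)
  define C where "C = (\<lambda>x. B x + R x)"
  have C: "bounded_clinear C" unfolding C_def using B R by (intro bounded_clinear_intros)
  interpret C: bounded_linear C using C by (rule bounded_clinear_bounded_linear)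
  have op_inv_A: "op_inv A = (\<lambda>y. Some (B y))" by (rule op_inv_eqI) (rule A_iff)
  have op_inv_V: "op_inv (op_id -\<^sub>o V) = (\<lambda>y. Some (R y))"
    by (rule op_inv_eqI) (simp add: op_diff_def V_eq dom_def R_iff)
  have alpha_max_eq: "alpha_max A V = 2 * Re_op (\<lambda>x. Some (C x))"
    unfolding alpha_max_def op_inv_A op_inv_V by (simp add: op_add_def dom_def C_def)
  \<comment> \<open>\<open>Re \<langle>x, B x\<rangle> = Re \<langle>A (B x), B x\<rangle>\<close>\<close>
  have B_acc: "0 \<le> rinner x (B x)" for x
  proof -
    have "ereal 0 \<le> Re_op A" using assms(3) by (simp add: accretive_def flip: zero_ereal_def)
    then have "0 \<le> rinner (B x) (the (A (B x)))"
      unfolding Re_op_ge_iff using dom_A by fastforce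
    then show ?thesis by (simp add: A_B rinner_commute)
  qed
  have B_dense: "closure (range B) = UNIV"
    using B.linear_axioms inj_B B_acc by (rule accretive_injective_dense_range)
  define \<mu> where "\<mu> = 1 + (1 - v) / (1 + v)"
  have \<mu>: "\<mu> > 1" using v by (simp add: \<mu>_def)
  have C_coercive: "\<mu> * (norm x)\<^sup>2 \<le> 2 * rinner x (C x)" for x
    using resolvent_coercive[of V' v R x, OF V'_le v inv_R] B_acc[of x]
    by (simp add: \<mu>_def C_def rinner_simps)
  have C_half: "\<mu> / 2 * (norm x)\<^sup>2 \<le> rinner x (C x)" for x using C_coercive[of x] by simp
  have "\<mu> / 2 > 0" using \<mu> by simp
  then obtain D where D: "bounded_clinear D" and D_iff: "\<And>x y. C x = y \<longleftrightarrow> x = D y"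
    using bounded_clinear_lax_milgram[OF C _ C_half] by blast
  have C_D: "C (D x) = x" for x using D_iff by blast

  have "ereal (\<mu> / 2) \<le> Re_op (\<lambda>x. Some (C x))"
    unfolding Re_op_ge_iff using C_half by simp
  then have "ereal \<mu> \<le> alpha_max A V"
    unfolding alpha_max_eq by (cases "Re_op (\<lambda>x. Some (C x))") auto
  moreover have "1 < ereal \<mu>" using \<mu> by (simp add: one_ereal_def)
  ultimately have gt: "alpha_max A V > 1" by (rule less_le_trans[rotated])

  have main: "invertible_op (preconditioner L V \<alpha>) \<and>
       (\<exists>!W. bounded_extension (op_id -\<^sub>o (op_inv (preconditioner L V \<alpha>) \<circ>\<^sub>m A)) W) \<and>
       (\<forall>W. bounded_extension (op_id -\<^sub>o (op_inv (preconditioner L V \<alpha>) \<circ>\<^sub>m A)) W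
              \<longrightarrow> op_norm W < 1)"
    if \<alpha>: "0 < \<alpha>" "ereal \<alpha> < alpha_max A V" for \<alpha> :: real
  proof -
    define G where "G = (\<lambda>y. \<alpha> *\<^sub>R (B (D (R y)) - V' (B (D (R y)))))"
    have G: "bounded_clinear G"
      unfolding G_def using B D R V'
      by (intro bounded_clinear_scaleR bounded_clinear_diff)
        (intro bounded_clinear_compose[OF V'] bounded_clinear_compose[OF B] bounded_clinear_compose[OF D] R)+
    have L_eq: "the (L (B z)) = z - V' (B z)" for z
    proof -
      have "B z \<in> dom A \<inter> dom L" using dom_A assms(5) by auto
      then have "(A -\<^sub>o L) (B z) = Some (z - the (L (B z)))"
        by (auto simp: op_diff_def A_B)
      moreover have "(A -\<^sub>o L) \<subseteq>\<^sub>m V" using assms(6) by (simp add: bounded_extension_def)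
      ultimately have "V (B z) = Some (z - the (L (B z)))"
        by (metis domI map_le_def)
      then show ?thesis by (simp add: V_eq)
    qed
    \<comment> \<open>\<open>L + I = A + (I - V)\<close>, parametrised by \<open>z = A p\<close> to avoid the unbounded operator.\<close>
    have LI_iff: "(L +\<^sub>o op_id) p = Some y \<longleftrightarrow> (\<exists>z. p = B z \<and> y = z + (p - V' p))" for p y
      using dom_A assms(5) by (auto simp: op_add_def dom_def[of Some] L_eq)
    have pre: "preconditioner L V \<alpha> x = (L +\<^sub>o op_id) (R (inverse \<alpha> *\<^sub>R x))" for x
      unfolding preconditioner_def op_inv_V
      by (simp add: map_comp_def op_scale_def scaleR_scaleC)
    have \<Gamma>_iff: "preconditioner L V \<alpha> x = Some y \<longleftrightarrow> x = G y" for x y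
    proof
      assume "preconditioner L V \<alpha> x = Some y"
      then obtain z where z: "R (inverse \<alpha> *\<^sub>R x) = B z" and y: "y = z + (B z - V' (B z))"
        unfolding pre LI_iff by auto
      have "R y = C z" by (simp add: y R.add R_inv C_def)
      then have "D (R y) = z" using D_iff by metis
      moreover have "inverse \<alpha> *\<^sub>R x = B z - V' (B z)" using z inv_R by metis
      ultimately have "G y = \<alpha> *\<^sub>R (inverse \<alpha> *\<^sub>R x)" by (simp add: G_def)
      then show "x = G y" using \<alpha>(1) by simp
    next
      assume x: "x = G y"
      \<comment> \<open>Here \<open>z = A p\<close> for the argument \<open>p = R (\<alpha>\<^sup>-\<^sup>1 x)\<close> of \<open>L + I\<close>.\<close>
      define z where "z = D (R y)"
      have "R (inverse \<alpha> *\<^sub>R x) = B z"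
        using \<alpha>(1) R_inv[of "B z"] by (simp add: x G_def z_def)
      moreover have "y = z + (B z - V' (B z))"
      proof -
        have "R (z + (B z - V' (B z))) = C z" by (simp add: R.add R_inv C_def)
        also have "\<dots> = R y" by (simp add: z_def C_D)
        finally show ?thesis by (metis inv_R)
      qed
      ultimately show "preconditioner L V \<alpha> x = Some y" unfolding pre LI_iff by auto
    qed
    have op_inv_\<Gamma>: "op_inv (preconditioner L V \<alpha>) = (\<lambda>y. Some (G y))"
      by (rule op_inv_eqI) (rule \<Gamma>_iff)
    have inv: "invertible_op (preconditioner L V \<alpha>)"
      unfolding invertible_op_def op_inv_\<Gamma> bounded_operator_total_iff by (rule G)
    \<comment> \<open>With \<open>w = C\<^sup>-\<^sup>1 R z\<close>, applying \<open>I - V\<close> to \<open>R z = B w + R w\<close> gives \<open>(I - V) B w = z - w\<close>,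
      while \<open>C (z - w) = C z - R z = B z\<close>.\<close>
    have G_eq: "G z = \<alpha> *\<^sub>R D (B z)" for z
    proof -
      define w where "w = D (R z)"
      have Cw: "C w = R z" by (simp add: w_def C_D)
      have "R (z - w) = B w" using Cw by (simp add: R.diff C_def algebra_simps)
      then have "B w - V' (B w) = z - w" using inv_R by metis
      moreover have "C (z - w) = B z" using Cw by (simp add: C.diff) (simp add: C_def)
      then have "z - w = D (B z)" using D_iff by metis
      ultimately show ?thesis by (simp add: G_def w_def)
    qed
    define F where "F = (\<lambda>x. x - \<alpha> *\<^sub>R D x)"
    have F: "bounded_clinear F"
      unfolding F_def using D by (intro bounded_clinear_intros)
    let ?T = "op_id -\<^sub>o (op_inv (preconditioner L V \<alpha>) \<circ>\<^sub>m A)"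
    have T_eq: "?T x = (if x \<in> range B then Some (F x) else None)" for x
    proof (cases "x \<in> range B")
      case True
      then obtain z where "x = B z" by auto
      then show ?thesis
        by (simp add: op_diff_def op_inv_\<Gamma> map_comp_def A_B dom_def F_def G_eq)
    next
      case False
      then have "A x = None" using dom_A by auto
      then show ?thesis using False by (simp add: op_diff_def op_inv_\<Gamma> map_comp_def dom_def)
    qed
    have ext: "bounded_extension ?T (\<lambda>x. Some (F x))"
      unfolding bounded_extension_def bounded_operator_total_iff
      using F by (auto simp: map_le_def dom_def T_eq)
    have uniq: "W = (\<lambda>x. Some (F x))" if W: "bounded_extension ?T W" for W
    proof -
      obtain f where f: "W = (\<lambda>x. Some (f x))" "bounded_clinear f"
        using W unfolding bounded_extension_def by (auto elim: bounded_operatorE)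
      have "f x = F x" if "x \<in> range B" for x
      proof -
        have "?T x = Some (F x)" using that by (simp add: T_eq)
        then have "W x = Some (F x)"
          using W unfolding bounded_extension_def by (metis domI map_le_def)
        then show ?thesis by (simp add: f)
      qed
      moreover have "closed {x. f x = F x}"
        using f(2) F by (intro closed_Collect_eq)
          (auto dest!: bounded_clinear_bounded_linear intro: linear_continuous_on)
      ultimately have "closure (range B) \<subseteq> {x. f x = F x}"
        by (intro closure_minimal) auto
      then show ?thesis using B_dense f by auto
    qed
    \<comment> \<open>A real bound strictly above \<open>\<alpha>\<close> is needed because \<open>\<alpha>\<^sub>m\<^sub>a\<^sub>x = \<infinity>\<close> on the zero space.\<close>
    obtain \<beta> where \<beta>: "ereal \<alpha> < ereal \<beta>" "ereal \<beta> < alpha_max A V"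
      using ereal_dense2[OF \<alpha>(2)] by auto
    have "ereal (\<beta> / 2) \<le> Re_op (\<lambda>x. Some (C x))"
      using \<beta>(2) unfolding alpha_max_eq by (cases "Re_op (\<lambda>x. Some (C x))") auto
    then have "\<beta> * (norm x)\<^sup>2 \<le> 2 * rinner x (C x)" for x
      unfolding Re_op_ge_iff by (auto dest!: spec[of _ x] simp: dom_def)
    then have "onorm F < 1"
      unfolding F_def using C C_D \<alpha>(1) \<beta>(1)
      by (intro onorm_ident_minus_inverse_less_1[of C D \<beta>]) auto
    then have "op_norm (\<lambda>x. Some (F x)) < 1" by (simp add: op_norm_def)
    with inv ext uniq show ?thesis by metis
  qed
  show ?thesis by (rule conjI[OF gt], intro allI impI, rule main) simp_all
qed

end
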